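(* Let $P\subseteq\mathbb{R}^d$ be a lattice $d$-polytope with codenominator $r$. Then $$\operatorname{Ehr}_{\mathbb{Q}}(P;t)=\frac{\operatorname{h}^*_{\mathbb{Q}}(P;t;r)}{(1-t)^{d+1}},$$ where $\operatorname{h}^*_{\mathbb{Q}}(P;t;r)$ is a polynomial in $\mathbb{Z}[t^{\frac1r}]$ with nonnegative coefficients.
   Context: A lattice polytope is the convex hull of finitely many points of $\mathbb{Z}^d$; a $d$-polytope is a $d$-dimensional polytope in $\mathbb{R}^d$, $d\ge1$. Codenominator: write a rational $d$-polytope $P$ by its irredundant halfspace description $P=\{\mathbf{x}\in\mathbb{R}^d:\mathbf{A}\mathbf{x}\le\mathbf{b}\}$ with $\mathbf{A}\in\mathbb{Z}^{n\times d}$, $\mathbf{b}\in\mathbb{Z}^n$, such that for every $i$ the greatest common divisor of $b_i$ and the entries of the $i$th row of $\mathbf{A}$ is $1$; the codenominator of $P$ is the (positive) least common multiple $r$ of the nonzero entries of $\mathbf{b}$. Put $\operatorname{ehr}_{\mathbb{Q}}(P;\lambda)=|\lambda P\cap\mathbb{Z}^d|$ for rational $\lambda\ge0$ and $\operatorname{Ehr}_{\mathbb{Q}}(P;t)=1+\sum_{n\in\mathbb{Z}_{>0}}\operatorname{ehr}_{\mathbb{Q}}(P;\frac nr)t^{\frac nr}$, a formal power series in $t^{1/r}$. *)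

theory Defs
  imports "HOL-Analysis.Analysis" "HOL-Computational_Algebra.Computational_Algebra"
begin

definition lattice_points :: "(real ^ 'd) set" where
  "lattice_points = {x. \<forall>j. x $ j \<in> \<int>}"

definition lattice_polytope :: "(real ^ 'd) set \<Rightarrow> bool" where
  "lattice_polytope P \<longleftrightarrow> (\<exists>V. finite V \<and> V \<subseteq> lattice_points \<and> P = convex hull V)"

(* An integral system A x \<le> b is given by the set of its rows (a, b). Nothing is lost by
   using a set: a repeated row is redundant, and the order of the rows is immaterial. *)
definition halfspace_intersection :: "((int ^ 'd) \<times> int) set \<Rightarrow> (real ^ 'd) set" where
  "halfspace_intersection H =
     {x. \<forall>(a, b)\<in>H. (\<Sum>j\<in>UNIV. real_of_int (a $ j) * x $ j) \<le> real_of_int b}"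

definition halfspace_description :: "(real ^ 'd) set \<Rightarrow> ((int ^ 'd) \<times> int) set \<Rightarrow> bool" where
  "halfspace_description P H \<longleftrightarrow>
     finite H \<and>
     P = halfspace_intersection H \<and>
     (\<forall>h\<in>H. halfspace_intersection (H - {h}) \<noteq> P) \<and>
     (\<forall>(a, b)\<in>H. Gcd (insert b (range (\<lambda>j. a $ j))) = 1)"

(* A full-dimensional rational polytope has exactly one description of this kind, so r is
   determined by P. Lcm on the integers is nonnegative, and here it is the lcm of finitely
   many nonzero numbers, hence positive. *)
definition has_codenominator :: "(real ^ 'd) set \<Rightarrow> nat \<Rightarrow> bool" where
  "has_codenominator P r \<longleftrightarrow>
     (\<exists>H. halfspace_description P H \<and> int r = Lcm {b \<in> snd ` H. b \<noteq> 0})"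

definition ehr :: "(real ^ 'd) set \<Rightarrow> rat \<Rightarrow> nat" where
  "ehr P l = card ((\<lambda>x. of_rat l *\<^sub>R x) ` P \<inter> lattice_points)"

(* Formal power series in t^(1/r) are ordinary ones in the variable fps_X = t^(1/r):
   the coefficient of t^(n/r) is the n-th coefficient, and t itself is fps_X ^ r. *)
definition Ehr :: "(real ^ 'd) set \<Rightarrow> nat \<Rightarrow> rat fps" where
  "Ehr P r = Abs_fps (\<lambda>n. if n = 0 then 1 else of_nat (ehr P (of_nat n / of_nat r)))"

end

theory Submission
  imports Defs
begin

text \<open>
  Put the polytope \<open>P = convex hull V\<close> at height \<open>1\<close> and take the cone over it, generated by the
  vectors \<open>(v, 1)\<close> with \<open>v \<in> V\<close>. Its slice at height \<open>t\<close> is \<open>t P\<close>, so the coefficient of \<open>t\<^bsup>n/r\<^esup>\<close>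
  in the Ehrhart series counts the points of height \<open>n/r\<close> in the cone whose first component is a
  lattice point (\<open>conical_hull_homogenization\<close>).

  The cone is a disjoint union of half-open simplicial cones whose generators are again of the form
  \<open>(v, 1)\<close> (\<open>half_open_decomposition\<close>). To see this, lift the generators to generic heights \<open>\<omega>\<close>; the bases
  \<open>B\<close> over which the lifting is strictly convex form a triangulation, in the sense that a point
  off all hyperplanes spanned by generators lies in exactly one simplicial cone. Uniqueness is a
  comparison of the linear interpolants of \<open>\<omega>\<close>
  (\<open>regular_triangulation_cones_disjoint\<close>), existence is linear programming: the cheapest way of
  writing the point as a nonnegative combination uses just the vectors of such a basis
  (\<open>regular_triangulation_covers_generic\<close>). An arbitrary point \<open>x\<close> of the cone is moved off the
  hyperplanes by a small step in a generic direction \<open>w\<close>, and is assigned to the simplicial cone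
  that contains the moved point. Which facets of a simplicial cone thereby get removed depends only
  on the signs of the coordinates of \<open>w\<close>.

  In one half-open simplicial cone, cutting down the coordinate of a generator \<open>b\<close> to a half-open
  unit interval means to remove the translate of the cone by \<open>b\<close>. As \<open>b\<close> is integral and of height
  \<open>1\<close>, this multiplies the generating function of the integral points by \<open>1 - t\<close>
  (\<open>height_series_truncate\<close>). After all \<open>d + 1\<close> coordinates have been cut down there
  remains a bounded half-open parallelepiped, whose generating function is a polynomial with
  nonnegative coefficients. The sum of these polynomials is the numerator.
\<close>

section \<open>Conical hulls and bases\<close>

definition conical_hull :: "'a::real_vector set \<Rightarrow> 'a set" where
  "conical_hull V = {x. \<exists>c. (\<forall>v\<in>V. 0 \<le> c v) \<and> x = (\<Sum>v\<in>V. c v *\<^sub>R v)}"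

definition bases :: "'a::euclidean_space set \<Rightarrow> 'a set set" where
  "bases V = {B. B \<subseteq> V \<and> independent B \<and> span B = UNIV}"

lemma conical_hull_add:
  assumes "x \<in> conical_hull V" "y \<in> conical_hull V"
  shows "x + y \<in> conical_hull V"
proof -
  obtain c d where "\<forall>v\<in>V. 0 \<le> c v" "x = (\<Sum>v\<in>V. c v *\<^sub>R v)"
      "\<forall>v\<in>V. 0 \<le> d v" "y = (\<Sum>v\<in>V. d v *\<^sub>R v)"
    using assms unfolding conical_hull_def by auto
  then show ?thesis
    unfolding conical_hull_def
    by (intro CollectI exI[of _ "\<lambda>v. c v + d v"]) (simp add: scaleR_left_distrib sum.distrib)
qed

lemma conical_hull_scaleR:
  assumes "x \<in> conical_hull V" "0 \<le> t"
  shows "t *\<^sub>R x \<in> conical_hull V"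
proof -
  obtain c where "\<forall>v\<in>V. 0 \<le> c v" "x = (\<Sum>v\<in>V. c v *\<^sub>R v)"
    using assms unfolding conical_hull_def by auto
  then show ?thesis
    unfolding conical_hull_def using assms(2)
    by (intro CollectI exI[of _ "\<lambda>v. t * c v"]) (simp add: scaleR_right.sum)
qed

text \<open>Adding one generator at a time, the set is a Minkowski sum of segments. It is used twice: to see
  that slices of a cone are bounded, and, for lifted generators, that a linear program on the cone
  attains its optimum.\<close>

lemma compact_bounded_combinations:
  fixes g :: "'a \<Rightarrow> 'b::real_normed_vector"
  assumes "finite V"
  shows "compact {\<Sum>v\<in>V. c v *\<^sub>R g v | c. \<forall>v\<in>V. 0 \<le> c v \<and> c v \<le> M}"
  using assms
proof (induction V rule: finite_induct)
  case empty
  then show ?case by simp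
next
  case (insert v V)
  let ?K = "\<lambda>V. {\<Sum>v\<in>V. c v *\<^sub>R g v | c. \<forall>v\<in>V. 0 \<le> c v \<and> c v \<le> M}"
  have "?K (insert v V) = {x + y | x y. x \<in> (\<lambda>t. t *\<^sub>R g v) ` {0..M} \<and> y \<in> ?K V}"
  proof (intro set_eqI iffI)
    fix z assume "z \<in> ?K (insert v V)"
    then obtain c where c: "\<forall>u\<in>insert v V. 0 \<le> c u \<and> c u \<le> M"
      and z: "z = (\<Sum>u\<in>insert v V. c u *\<^sub>R g u)"
      by auto
    have "c v *\<^sub>R g v \<in> (\<lambda>t. t *\<^sub>R g v) ` {0..M}" "(\<Sum>u\<in>V. c u *\<^sub>R g u) \<in> ?K V"
      using c by auto
    then show "z \<in> {x + y | x y. x \<in> (\<lambda>t. t *\<^sub>R g v) ` {0..M} \<and> y \<in> ?K V}"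
      using insert.hyps z by auto
  next
    fix z assume "z \<in> {x + y | x y. x \<in> (\<lambda>t. t *\<^sub>R g v) ` {0..M} \<and> y \<in> ?K V}"
    then obtain t c where t: "0 \<le> t" "t \<le> M" and c: "\<forall>u\<in>V. 0 \<le> c u \<and> c u \<le> M"
      and z: "z = t *\<^sub>R g v + (\<Sum>u\<in>V. c u *\<^sub>R g u)"
      by auto
    have "(\<Sum>u\<in>V. (c(v := t)) u *\<^sub>R g u) = (\<Sum>u\<in>V. c u *\<^sub>R g u)"
      using insert.hyps by (intro sum.cong) auto
    then have "z = (\<Sum>u\<in>insert v V. (c(v := t)) u *\<^sub>R g u)"
      using insert.hyps z by simp
    then show "z \<in> ?K (insert v V)"
      using t c by (intro CollectI exI[of _ "c(v := t)"]) auto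
  qed
  moreover have "compact ((\<lambda>t. t *\<^sub>R g v) ` {0..M})"
    by (intro compact_continuous_image continuous_intros) auto
  ultimately show ?case
    using compact_sums[OF _ insert.IH] by simp
qed

text \<open>With all generators at height \<open>1\<close>, the coefficients of a combination add up to its height; this
  is what keeps the coefficients bounded.\<close>

lemma coefficients_le_height:
  fixes h :: "'a::real_vector \<Rightarrow> real"
  assumes "finite V" "linear h" "\<forall>v\<in>V. h v = 1"
    and "\<forall>v\<in>V. 0 \<le> c v" "x = (\<Sum>v\<in>V. c v *\<^sub>R v)"
  shows "h x = sum c V" and "\<forall>v\<in>V. 0 \<le> c v \<and> c v \<le> h x"
proof -
  show hx: "h x = sum c V"
    using assms by (simp add: linear_sum linear_cmul)
  show "\<forall>v\<in>V. 0 \<le> c v \<and> c v \<le> h x"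
    using assms(1,4) by (auto simp: hx intro: member_le_sum)
qed

lemma bounded_conical_hull_slice:
  fixes h :: "'a::euclidean_space \<Rightarrow> real"
  assumes "finite V" "linear h" "\<forall>v\<in>V. h v = 1"
  shows "bounded {x \<in> conical_hull V. h x = t}"
proof (rule bounded_subset)
  show "bounded {\<Sum>v\<in>V. c v *\<^sub>R v | c. \<forall>v\<in>V. 0 \<le> c v \<and> c v \<le> t}"
    by (rule compact_imp_bounded[OF compact_bounded_combinations[OF assms(1)]])
  show "{x \<in> conical_hull V. h x = t} \<subseteq> {\<Sum>v\<in>V. c v *\<^sub>R v | c. \<forall>v\<in>V. 0 \<le> c v \<and> c v \<le> t}"
    unfolding conical_hull_def using coefficients_le_height(2)[OF assms] by blast
qed

lemma finite_bases: "finite V \<Longrightarrow> finite (bases V)"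
  unfolding bases_def by (rule finite_subset[of _ "Pow V"]) auto

lemma basesD:
  fixes x :: "'a::euclidean_space"
  assumes "B \<in> bases V"
  shows "B \<subseteq> V" "independent B" "x \<in> span B" "finite B" "card B = DIM('a)"
proof -
  show B: "B \<subseteq> V" "independent B" "x \<in> span B" "finite B"
    using assms by (auto simp: bases_def independent_imp_finite)
  have "card B = dim (span B)"
    using B(2) dim_span_eq_card_independent by metis
  also have "span B = UNIV"
    using assms by (simp add: bases_def)
  finally show "card B = DIM('a)"
    by simp
qed

lemma independent_extends_to_basis:
  assumes "S \<subseteq> V" "independent S" "span V = UNIV"
  obtains B where "B \<in> bases V" "S \<subseteq> B"
proof -
  obtain B where B: "S \<subseteq> B" "B \<subseteq> V" "independent B" "V \<subseteq> span B"
    using maximal_independent_subset_extend[OF assms(1,2)] by metis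
  then have "span B = UNIV"
    using assms(3) span_mono span_span by (metis top.extremum_uniqueI)
  with B that show thesis by (auto simp: bases_def)
qed

lemma representation_outside: "b \<notin> B \<Longrightarrow> representation B x b = 0"
  using representation_ne_zero by blast

lemma basis_expansion:
  assumes "B \<in> bases V"
  shows "(\<Sum>b\<in>B. representation B x b *\<^sub>R b) = x"
  using basesD[OF assms] real_vector.sum_representation_eq by blast

lemma basis_representation_add:
  "B \<in> bases V \<Longrightarrow> representation B (x + y) b = representation B x b + representation B y b"
  using basesD by (metis real_vector.representation_add)

lemma basis_representation_diff:
  "B \<in> bases V \<Longrightarrow> representation B (x - y) b = representation B x b - representation B y b"
  using basesD by (metis real_vector.representation_diff)

lemma basis_representation_scaleR:
  "B \<in> bases V \<Longrightarrow> representation B (t *\<^sub>R x) b = t * representation B x b"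
  using basesD by (metis real_vector.representation_scale)

lemma basis_representation_self:
  "B \<in> bases V \<Longrightarrow> b \<in> B \<Longrightarrow> representation B b a = (if a = b then 1 else 0)"
  using basesD by (metis representation_basis)

lemma basis_representation_combination:
  assumes "B \<in> bases V"
  shows "representation B (\<Sum>v\<in>A. c v *\<^sub>R v) b = (\<Sum>v\<in>A. c v * representation B v b)"
  using assms basesD[OF assms]
  by (subst real_vector.representation_sum) (auto simp: basis_representation_scaleR)

lemma height_eq_sum_coordinates:
  fixes h :: "'a::euclidean_space \<Rightarrow> real"
  assumes "B \<in> bases V" "linear h" "\<forall>v\<in>V. h v = 1"
  shows "h x = (\<Sum>b\<in>B. representation B x b)"
proof -
  have "h x = h (\<Sum>b\<in>B. representation B x b *\<^sub>R b)"
    using basis_expansion[OF assms(1)] by simp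
  also have "\<dots> = (\<Sum>b\<in>B. representation B x b * h b)"
    using assms(2) by (simp add: linear_sum linear_cmul)
  also have "\<dots> = (\<Sum>b\<in>B. representation B x b)"
    using assms(3) basesD(1)[OF assms(1)] by (intro sum.cong) auto
  finally show ?thesis .
qed

section \<open>Generic heights and generic directions\<close>

lemma exists_positive_nonroot:
  fixes Q :: "real poly set"
  assumes "finite Q" "0 \<notin> Q"
  obtains s where "0 < s" "\<forall>q\<in>Q. poly q s \<noteq> 0"
proof -
  have "finite (\<Union>q\<in>Q. {s. poly q s = 0})"
    using assms by (intro finite_UN_I) (auto intro!: poly_roots_finite)
  then have "\<not> {0<..} \<subseteq> (\<Union>q\<in>Q. {s. poly q s = 0})"
    using infinite_Ioi[of "0::real"] finite_subset by blast
  then show thesis using that by auto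
qed

text \<open>The linear functional that agrees with \<open>\<omega>\<close> on the basis \<open>B\<close>.\<close>

definition interpolant :: "'a::real_vector set \<Rightarrow> ('a \<Rightarrow> real) \<Rightarrow> 'a \<Rightarrow> real" where
  "interpolant B \<omega> x = (\<Sum>b\<in>B. representation B x b * \<omega> b)"

text \<open>The heights are the powers \<open>s ^ f v\<close> with distinct exponents. Each forbidden coincidence is then a
  polynomial equation for \<open>s\<close>, and the equation is not trivial because the exponent \<open>f v\<close> does not
  occur among those of the basis. Finitely many such equations leave some \<open>s\<close>.\<close>

lemma exists_generic_heights:
  fixes V :: "'a::euclidean_space set"
  assumes "finite V"
  obtains \<omega> where "\<forall>B\<in>bases V. \<forall>v\<in>V - B. interpolant B \<omega> v \<noteq> \<omega> v"
proof -
  obtain f :: "'a \<Rightarrow> nat" where f: "inj_on f V"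
    using finite_imp_inj_to_nat_seg[OF assms] by blast
  define q where "q = (\<lambda>(B, v). monom 1 (f v) - (\<Sum>b\<in>B. monom (representation B v b) (f b)))"
  let ?I = "{(B, v). B \<in> bases V \<and> v \<in> V - B}"
  have finI: "finite (q ` ?I)"
    using assms finite_bases[OF assms] by (intro finite_imageI finite_subset[of ?I "bases V \<times> V"]) auto
  have "q (B, v) \<noteq> 0" if "B \<in> bases V" "v \<in> V - B" for B v
  proof -
    have "f b \<noteq> f v" if "b \<in> B" for b
      using that \<open>v \<in> V - B\<close> basesD(1)[OF \<open>B \<in> bases V\<close>] f by (auto dest: inj_onD)
    then have "coeff (q (B, v)) (f v) = 1"
      by (simp add: q_def coeff_sum)
    then show ?thesis by auto
  qed
  then have "0 \<notin> q ` ?I" by (auto dest: sym)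
  then obtain s where s: "\<forall>p\<in>q ` ?I. poly p s \<noteq> 0"
    using exists_positive_nonroot[OF finI] by blast
  have "interpolant B (\<lambda>v. s ^ f v) v \<noteq> s ^ f v" if "B \<in> bases V" "v \<in> V - B" for B v
  proof -
    have "poly (q (B, v)) s \<noteq> 0" using s that by auto
    then show ?thesis by (simp add: q_def interpolant_def poly_sum poly_monom)
  qed
  then show thesis using that by blast
qed

text \<open>A point is generic if it avoids the hyperplanes spanned by generators.\<close>

definition generic :: "'a::euclidean_space set \<Rightarrow> 'a \<Rightarrow> bool" where
  "generic V x \<longleftrightarrow> (\<forall>B\<in>bases V. \<forall>b\<in>B. representation B x b \<noteq> 0)"

text \<open>The same choice of powers of \<open>s\<close> as coefficients: the coordinate of \<open>w\<close> at \<open>b\<close> is a polynomial in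
  \<open>s\<close>, in which the generator \<open>b\<close> itself contributes the coefficient \<open>1\<close>.\<close>

lemma exists_generic_direction:
  fixes V :: "'a::euclidean_space set"
  assumes "finite V"
  obtains w where "w \<in> conical_hull V" "generic V w"
proof -
  obtain f :: "'a \<Rightarrow> nat" where f: "inj_on f V"
    using finite_imp_inj_to_nat_seg[OF assms] by blast
  define q where "q = (\<lambda>(B, b). \<Sum>v\<in>V. monom (representation B v b) (f v))"
  let ?I = "{(B, b). B \<in> bases V \<and> b \<in> B}"
  have finI: "finite (q ` ?I)"
    using assms finite_bases[OF assms] basesD(1)
    by (intro finite_imageI finite_subset[of ?I "bases V \<times> V"]) auto
  have "q (B, b) \<noteq> 0" if "B \<in> bases V" "b \<in> B" for B b
  proof -
    have b: "b \<in> V" using basesD(1) that by auto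
    have "coeff (q (B, b)) (f b) = (\<Sum>v\<in>V. if v = b then representation B v b else 0)"
      unfolding q_def using f b by (auto simp: coeff_sum inj_on_eq_iff intro!: sum.cong)
    also have "\<dots> = 1"
      using assms b basis_representation_self[OF that] by simp
    finally show ?thesis by auto
  qed
  then have "0 \<notin> q ` ?I" by (auto dest: sym)
  then obtain s where s: "0 < s" "\<forall>p\<in>q ` ?I. poly p s \<noteq> 0"
    using exists_positive_nonroot[OF finI] by blast
  define w where "w = (\<Sum>v\<in>V. s ^ f v *\<^sub>R v)"
  have "w \<in> conical_hull V"
    unfolding conical_hull_def w_def using s(1)
    by (intro CollectI exI[of _ "\<lambda>v. s ^ f v"]) simp
  moreover have "representation B w b \<noteq> 0" if "B \<in> bases V" "b \<in> B" for B b
  proof -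
    have "poly (q (B, b)) s \<noteq> 0" using s that by auto
    then show ?thesis
      using that(1)
      by (simp add: q_def w_def poly_sum poly_monom basis_representation_combination mult.commute)
  qed
  ultimately show thesis using that by (simp add: generic_def)
qed

section \<open>The regular triangulation of a cone\<close>

text \<open>The bases that span the lower facets of the cone over the lifted points \<open>(v, \<omega> v)\<close>. In terms of
  the linear program that minimises \<open>\<Sum>v\<in>V. c v * \<omega> v\<close> over the nonnegative coefficients \<open>c\<close> of a given
  point, these are the bases with all reduced costs positive.\<close>

definition regular_triangulation :: "'a::euclidean_space set \<Rightarrow> ('a \<Rightarrow> real) \<Rightarrow> 'a set set" where
  "regular_triangulation V \<omega> = {B \<in> bases V. \<forall>v\<in>V - B. interpolant B \<omega> v < \<omega> v}"

lemma interpolant_combination: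
  assumes "B \<in> bases V"
  shows "interpolant B \<omega> (\<Sum>v\<in>A. c v *\<^sub>R v) = (\<Sum>v\<in>A. c v * interpolant B \<omega> v)"
proof -
  have "interpolant B \<omega> (\<Sum>v\<in>A. c v *\<^sub>R v) = (\<Sum>b\<in>B. \<Sum>v\<in>A. c v * representation B v b * \<omega> b)"
    using assms by (simp add: interpolant_def basis_representation_combination sum_distrib_right)
  also have "\<dots> = (\<Sum>v\<in>A. c v * interpolant B \<omega> v)"
    by (subst sum.swap) (simp add: interpolant_def sum_distrib_left mult.assoc)
  finally show ?thesis .
qed

lemma interpolant_self:
  assumes "B \<in> bases V" "b \<in> B"
  shows "interpolant B \<omega> b = \<omega> b"
proof -
  have "interpolant B \<omega> b = (\<Sum>a\<in>B. if a = b then \<omega> a else 0)"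
    unfolding interpolant_def using assms
    by (intro sum.cong) (auto simp: basis_representation_self)
  then show ?thesis
    using assms basesD(4)[OF assms(1)] by simp
qed

text \<open>Expand \<open>x\<close> in \<open>B'\<close>. The interpolant of \<open>B\<close> lies below \<open>\<omega>\<close> on \<open>V\<close>, so its value at \<open>x\<close> is at most that
  of the interpolant of \<open>B'\<close>. By symmetry the two values agree. Since the coordinates are positive, the
  interpolant of \<open>B\<close> then touches \<open>\<omega>\<close> on all of \<open>B'\<close>, which it does on \<open>B\<close> only.\<close>

lemma regular_triangulation_cones_disjoint:
  assumes "B \<in> regular_triangulation V \<omega>" "B' \<in> regular_triangulation V \<omega>"
    and "\<forall>b\<in>B. 0 < representation B x b" "\<forall>b\<in>B'. 0 < representation B' x b"
  shows "B = B'"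
proof -
  have le: "interpolant B \<omega> x \<le> interpolant B' \<omega> x"
      "interpolant B \<omega> x = interpolant B' \<omega> x \<Longrightarrow> B' \<subseteq> B"
    if B: "B \<in> regular_triangulation V \<omega>" and B': "B' \<in> regular_triangulation V \<omega>"
      and pos: "\<forall>b\<in>B'. 0 < representation B' x b" for B B'
  proof -
    have bases: "B \<in> bases V" "B' \<in> bases V"
      using B B' by (auto simp: regular_triangulation_def)
    have 1: "interpolant B \<omega> x = (\<Sum>b\<in>B'. representation B' x b * interpolant B \<omega> b)"
      using interpolant_combination[OF bases(1), of \<omega> "representation B' x" B']
        basis_expansion[OF bases(2)] by metis
    have 2: "interpolant B \<omega> b \<le> \<omega> b" "b \<notin> B \<Longrightarrow> interpolant B \<omega> b < \<omega> b" if "b \<in> B'" for b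
      using that B basesD(1)[OF bases(2)] interpolant_self[OF bases(1), of b \<omega>]
      by (cases "b \<in> B"; force simp: regular_triangulation_def)+
    have 3: "representation B' x b * interpolant B \<omega> b \<le> representation B' x b * \<omega> b" if "b \<in> B'" for b
      using 2(1)[OF that] pos that by (intro mult_left_mono) (auto intro: less_imp_le)
    show "interpolant B \<omega> x \<le> interpolant B' \<omega> x"
      unfolding 1 interpolant_def[of B'] by (intro sum_mono 3)
    show "B' \<subseteq> B" if eq: "interpolant B \<omega> x = interpolant B' \<omega> x"
    proof (rule ccontr)
      assume "\<not> B' \<subseteq> B"
      then obtain a where a: "a \<in> B'" "a \<notin> B" by auto
      then have "representation B' x a * interpolant B \<omega> a < representation B' x a * \<omega> a"
        using 2(2) pos by simp
      then have "interpolant B \<omega> x < interpolant B' \<omega> x"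
        unfolding 1 interpolant_def[of B']
        using a 3 basesD(4)[OF bases(2)] by (intro sum_strict_mono_ex1) auto
      with eq show False by simp
    qed
  qed
  show ?thesis
    using le[OF assms(1,2,4)] le[OF assms(2,1,3)] by auto
qed

text \<open>The lifted combinations \<open>(\<Sum>v\<in>V. c v *\<^sub>R v, \<Sum>v\<in>V. c v * \<omega> v)\<close> with bounded coefficients form a compact
  set, and the height bounds all coefficients of \<open>x\<close>. So the lowest point above \<open>x\<close> exists.\<close>

lemma exists_cheapest_coefficients:
  fixes h :: "'a::euclidean_space \<Rightarrow> real"
  assumes "finite V" "linear h" "\<forall>v\<in>V. h v = 1" "x \<in> conical_hull V"
  obtains c where "\<forall>v\<in>V. 0 \<le> c v" "x = (\<Sum>v\<in>V. c v *\<^sub>R v)"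
    "\<And>d. \<forall>v\<in>V. 0 \<le> d v \<Longrightarrow> x = (\<Sum>v\<in>V. d v *\<^sub>R v) \<Longrightarrow> (\<Sum>v\<in>V. c v * \<omega> v) \<le> (\<Sum>v\<in>V. d v * \<omega> v)"
proof -
  let ?g = "\<lambda>v. (v, \<omega> v)"
  define K where "K = {\<Sum>v\<in>V. c v *\<^sub>R ?g v | c. \<forall>v\<in>V. 0 \<le> c v \<and> c v \<le> h x} \<inter> {x} \<times> UNIV"
  have g: "(\<Sum>v\<in>V. c v *\<^sub>R ?g v) = (\<Sum>v\<in>V. c v *\<^sub>R v, \<Sum>v\<in>V. c v * \<omega> v)" for c
    by (simp add: scaleR_prod_def sum_prod)
  have mem: "(x, \<Sum>v\<in>V. d v * \<omega> v) \<in> K"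
    if "\<forall>v\<in>V. 0 \<le> d v" "x = (\<Sum>v\<in>V. d v *\<^sub>R v)" for d
  proof -
    have "\<forall>v\<in>V. 0 \<le> d v \<and> d v \<le> h x"
      using coefficients_le_height(2)[OF assms(1-3) that] .
    then show ?thesis
      unfolding K_def g using that(2) by blast
  qed
  have "compact K"
    unfolding K_def
    by (intro compact_Int_closed compact_bounded_combinations assms(1) closed_Times) auto
  moreover have "K \<noteq> {}"
    using assms(4) mem unfolding conical_hull_def by blast
  ultimately have "\<exists>p\<in>K. \<forall>q\<in>K. snd p \<le> snd q"
    by (intro continuous_attains_inf continuous_on_snd continuous_on_id)
  then obtain p where p: "p \<in> K" "\<And>q. q \<in> K \<Longrightarrow> snd p \<le> snd q"
    by blast
  from p(1) obtain c where c: "\<forall>v\<in>V. 0 \<le> c v" "p = (x, \<Sum>v\<in>V. c v * \<omega> v)"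
      "x = (\<Sum>v\<in>V. c v *\<^sub>R v)"
    unfolding K_def g by auto
  show thesis
    using that[of c] c p(2)[OF mem] by simp
qed

text \<open>A linear relation \<open>u\<close> among the generators can be added to the optimal coefficients \<open>c\<close> in a small
  multiple, as long as it decreases positive coefficients only. By optimality the cost does not
  decrease.\<close>

lemma cheapest_coefficients_perturbation:
  fixes V :: "'a::real_vector set"
  assumes "finite V" "\<forall>v\<in>V. 0 \<le> c v" "x = (\<Sum>v\<in>V. c v *\<^sub>R v)"
    and min: "\<And>d. \<forall>v\<in>V. 0 \<le> d v \<Longrightarrow> x = (\<Sum>v\<in>V. d v *\<^sub>R v) \<Longrightarrow>
      (\<Sum>v\<in>V. c v * \<omega> v) \<le> (\<Sum>v\<in>V. d v * \<omega> v)"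
    and u: "(\<Sum>v\<in>V. u v *\<^sub>R v) = 0" "\<And>v. v \<in> V \<Longrightarrow> u v < 0 \<Longrightarrow> 0 < c v"
  shows "0 \<le> (\<Sum>v\<in>V. u v * \<omega> v)"
proof -
  have "\<forall>\<^sub>F t in at_right 0. \<forall>v\<in>V. 0 \<le> c v + t * u v"
  proof (intro eventually_ball_finite ballI assms(1))
    fix v assume v: "v \<in> V"
    show "\<forall>\<^sub>F t in at_right 0. 0 \<le> c v + t * u v"
    proof (cases "u v < 0")
      case True
      have "((\<lambda>t. c v + t * u v) \<longlongrightarrow> c v + 0 * u v) (at_right 0)"
        by (intro tendsto_intros)
      then have "\<forall>\<^sub>F t in at_right 0. 0 < c v + t * u v"
        using u(2)[OF v True] by (intro order_tendstoD) auto
      then show ?thesis by (rule eventually_mono) simp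
    next
      case False
      then show ?thesis
        using assms(2) v by (auto simp: eventually_at_right_less intro!: eventually_at_rightI[of 0 1])
    qed
  qed
  moreover have "\<forall>\<^sub>F t::real in at_right 0. 0 < t"
    by (simp add: eventually_at_right_less)
  ultimately obtain t where t: "0 < t" "\<forall>v\<in>V. 0 \<le> c v + t * u v"
    using eventually_happens'[OF trivial_limit_at_right_real] eventually_conj by blast
  have "(\<Sum>v\<in>V. (c v + t * u v) *\<^sub>R v) = x + t *\<^sub>R (\<Sum>v\<in>V. u v *\<^sub>R v)"
    by (simp add: assms(3) scaleR_left_distrib sum.distrib scaleR_sum_right)
  then have "(\<Sum>v\<in>V. c v * \<omega> v) \<le> (\<Sum>v\<in>V. (c v + t * u v) * \<omega> v)"
    using u(1) t(2) by (intro min) auto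
  also have "\<dots> = (\<Sum>v\<in>V. c v * \<omega> v) + t * (\<Sum>v\<in>V. u v * \<omega> v)"
    by (simp add: distrib_right sum.distrib sum_distrib_left mult.assoc)
  finally show ?thesis using t(1) by (simp add: zero_le_mult_iff)
qed

text \<open>Take the cheapest coefficients of \<open>x\<close>. If their support were dependent, a relation inside the support
  could be added and subtracted, so its cost would vanish, against the genericity of \<open>\<omega>\<close>. Hence the
  support is independent, and for generic \<open>x\<close> it must be a whole basis \<open>B\<close>. Now every \<open>v\<close> outside
  \<open>B\<close> gives a relation that decreases coefficients on \<open>B\<close> only; that its cost is nonnegative says that
  \<open>B\<close> belongs to the triangulation.\<close>

lemma regular_triangulation_covers_generic:
  fixes h :: "'a::euclidean_space \<Rightarrow> real"
  assumes V: "finite V" "span V = UNIV" and h: "linear h" "\<forall>v\<in>V. h v = 1"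
    and \<omega>: "\<forall>B\<in>bases V. \<forall>v\<in>V - B. interpolant B \<omega> v \<noteq> \<omega> v"
    and x: "x \<in> conical_hull V" "generic V x"
  obtains B where "B \<in> regular_triangulation V \<omega>" "\<forall>b\<in>B. 0 < representation B x b"
proof -
  obtain c where c: "\<forall>v\<in>V. 0 \<le> c v" "x = (\<Sum>v\<in>V. c v *\<^sub>R v)"
    and min: "\<And>d. \<forall>v\<in>V. 0 \<le> d v \<Longrightarrow> x = (\<Sum>v\<in>V. d v *\<^sub>R v) \<Longrightarrow>
      (\<Sum>v\<in>V. c v * \<omega> v) \<le> (\<Sum>v\<in>V. d v * \<omega> v)"
    using exists_cheapest_coefficients[OF V(1) h x(1)] by blast
  note perturb = cheapest_coefficients_perturbation[OF V(1) c min]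
  define S where "S = {v \<in> V. 0 < c v}"
  \<comment> \<open>The linear relation expressing \<open>v\<close> through \<open>B\<close>, as a vector of coefficients.\<close>
  define u :: "'a set \<Rightarrow> 'a \<Rightarrow> 'a \<Rightarrow> real"
    where "u = (\<lambda>B v y. (if y = v then 1 else 0) - representation B v y)"
  have u: "(\<Sum>y\<in>V. u B v y *\<^sub>R y) = 0" "(\<Sum>y\<in>V. u B v y * \<omega> y) = \<omega> v - interpolant B \<omega> v"
    if B: "B \<in> bases V" and v: "v \<in> V" for B v
  proof -
    have "(\<Sum>y\<in>V. representation B v y *\<^sub>R y) = v"
      using basesD[OF B] V(1) by (intro real_vector.sum_representation_eq) auto
    then show "(\<Sum>y\<in>V. u B v y *\<^sub>R y) = 0"
      using V(1) v
      by (simp add: u_def scaleR_left_diff_distrib sum_subtractf if_distrib[of "\<lambda>a. a *\<^sub>R _"] cong: if_cong)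
    have "(\<Sum>y\<in>V. representation B v y * \<omega> y) = interpolant B \<omega> v"
      unfolding interpolant_def using basesD(1)[OF B] V(1)
      by (intro sum.mono_neutral_right) (auto simp: representation_outside)
    then show "(\<Sum>y\<in>V. u B v y * \<omega> y) = \<omega> v - interpolant B \<omega> v"
      using V(1) v
      by (simp add: u_def left_diff_distrib sum_subtractf if_distrib[of "\<lambda>a. a * _"] cong: if_cong)
  qed
  \<comment> \<open>A dependent support would contain a relation with cost zero.\<close>
  have "independent S"
  proof (rule ccontr)
    assume "\<not> independent S"
    then obtain v where v: "v \<in> S" "v \<in> span (S - {v})"
      by (auto simp: dependent_def)
    obtain S' where S': "S' \<subseteq> S - {v}" "independent S'" "S - {v} \<subseteq> span S'"
      using maximal_independent_subset by metis
    have vS': "v \<in> span S'"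
      using v(2) S'(3) span_mono span_span by blast
    obtain B where B: "B \<in> bases V" "S' \<subseteq> B"
      using independent_extends_to_basis[OF _ S'(2) V(2)] S'(1) unfolding S_def by blast
    have vB: "v \<in> V - B"
    proof -
      have "v \<notin> B"
      proof
        assume "v \<in> B"
        moreover have "v \<in> span (B - {v})"
          using vS' span_mono[of S' "B - {v}"] S'(1) B(2) by blast
        ultimately show False
          using basesD(2)[OF B(1)] by (auto simp: dependent_def)
      qed
      then show ?thesis using v(1) by (simp add: S_def)
    qed
    have supp: "0 < c y" if "u B v y \<noteq> 0" for y
    proof -
      have "representation B v = representation S' v"
        using basesD(2)[OF B(1)] vS' B(2) by (rule representation_extend)
      then have "y \<in> S"
        using that v(1) S'(1) representation_outside[of y S' v]
        by (auto simp: u_def split: if_splits)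
      then show ?thesis by (simp add: S_def)
    qed
    have "0 \<le> (\<Sum>y\<in>V. u B v y * \<omega> y)"
      using supp u(1)[OF B(1)] vB by (intro perturb) auto
    moreover have "0 \<le> (\<Sum>y\<in>V. - u B v y * \<omega> y)"
      using supp u(1)[OF B(1)] vB by (intro perturb) (auto simp: sum_negf)
    ultimately have "interpolant B \<omega> v = \<omega> v"
      using u(2)[OF B(1)] vB by (simp add: sum_negf)
    with \<omega> B(1) vB show False by blast
  qed
  moreover have "S \<subseteq> V" by (auto simp: S_def)
  ultimately obtain B where B: "B \<in> bases V" "S \<subseteq> B"
    using independent_extends_to_basis V(2) by metis
  have rep: "representation B x b = c b" if b: "b \<in> B" for b
  proof -
    have "representation B x b = (\<Sum>v\<in>V. c v * representation B v b)"
      using B(1) by (simp add: c(2) basis_representation_combination)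
    also have "\<dots> = (\<Sum>v\<in>V. if v = b then c v else 0)"
    proof (intro sum.cong refl)
      fix v assume v: "v \<in> V"
      show "c v * representation B v b = (if v = b then c v else 0)"
      proof (cases "v \<in> B")
        case True
        then show ?thesis using basis_representation_self[OF B(1)] by auto
      next
        case False
        then have "c v = 0" using B(2) c(1) v unfolding S_def by force
        then show ?thesis by auto
      qed
    qed
    also have "\<dots> = c b" using b V(1) basesD(1)[OF B(1)] by auto
    finally show ?thesis .
  qed
  \<comment> \<open>Since \<open>x\<close> is generic, the basis has no vectors besides the support.\<close>
  have pos: "0 < c b" if "b \<in> B" for b
    using x(2) B(1) that rep[OF that] c(1) basesD(1)[OF B(1)]
    unfolding generic_def by (metis less_eq_real_def subsetD)
  have "interpolant B \<omega> v < \<omega> v" if v: "v \<in> V - B" for v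
  proof -
    have "0 \<le> (\<Sum>y\<in>V. u B v y * \<omega> y)"
    proof (rule perturb)
      show "(\<Sum>y\<in>V. u B v y *\<^sub>R y) = 0" using u(1)[OF B(1)] v by simp
      show "0 < c y" if "u B v y < 0" for y
      proof -
        have "y \<in> B"
          using that v representation_outside[of y B v] by (auto simp: u_def split: if_splits)
        then show ?thesis by (rule pos)
      qed
    qed
    then show ?thesis
      using u(2)[OF B(1)] v \<omega> B(1) by force
  qed
  then show thesis
    using that[of B] B(1) pos rep by (simp add: regular_triangulation_def)
qed

section \<open>Half-open cones\<close>

text \<open>The condition on a coordinate \<open>t\<close> for \<open>t + e * \<mu>\<close> to be positive for all small \<open>e > 0\<close>, provided that
  \<open>\<mu> \<noteq> 0\<close>.\<close>

definition admissible :: "real \<Rightarrow> real \<Rightarrow> bool" where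
  "admissible \<mu> t \<longleftrightarrow> 0 \<le> t \<and> (\<mu> < 0 \<longrightarrow> 0 < t)"

definition half_open_cone :: "'a::real_vector set \<Rightarrow> 'a \<Rightarrow> 'a set" where
  "half_open_cone B w = {x. \<forall>b\<in>B. admissible (representation B w b) (representation B x b)}"

lemma eventually_positive_iff_admissible:
  assumes "\<mu> \<noteq> 0"
  shows "\<forall>\<^sub>F e in at_right 0. t + e * \<mu> \<noteq> 0 \<and> (0 < t + e * \<mu> \<longleftrightarrow> admissible \<mu> t)"
proof -
  have lim: "((\<lambda>e. t + e * \<mu>) \<longlongrightarrow> t + 0 * \<mu>) (at_right 0)"
    by (intro tendsto_intros)
  consider "t < 0" | "t = 0" | "0 < t" by linarith
  then show ?thesis
  proof cases
    case 1
    then have "\<forall>\<^sub>F e in at_right 0. t + e * \<mu> < 0"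
      using lim by (intro order_tendstoD) auto
    then show ?thesis by eventually_elim (use 1 in \<open>auto simp: admissible_def\<close>)
  next
    case 2
    have "\<forall>\<^sub>F e::real in at_right 0. 0 < e"
      by (simp add: eventually_at_right_less)
    then show ?thesis
      by eventually_elim (use 2 assms in \<open>auto simp: admissible_def zero_less_mult_iff\<close>)
  next
    case 3
    then have "\<forall>\<^sub>F e in at_right 0. 0 < t + e * \<mu>"
      using lim by (intro order_tendstoD) auto
    then show ?thesis by eventually_elim (use 3 in \<open>auto simp: admissible_def\<close>)
  qed
qed

lemma half_open_cone_subset:
  assumes "finite V" "B \<in> bases V"
  shows "half_open_cone B w \<subseteq> conical_hull V"
proof
  fix x assume x: "x \<in> half_open_cone B w"
  have "x = (\<Sum>v\<in>V. representation B x v *\<^sub>R v)"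
    using assms basesD[OF assms(2)] by (intro real_vector.sum_representation_eq[symmetric]) auto
  moreover have "0 \<le> representation B x v" for v
    using x representation_outside[of v B x]
    by (cases "v \<in> B") (auto simp: half_open_cone_def admissible_def)
  ultimately show "x \<in> conical_hull V"
    unfolding conical_hull_def by blast
qed

text \<open>By the choice of the half-open cones, \<open>x\<close> lies in the one of \<open>B\<close> iff \<open>x + e *\<^sub>R w\<close> has positive
  coordinates in \<open>B\<close>, for small \<open>e > 0\<close>. As there are finitely many bases, one \<open>e\<close> serves them all, and
  the point \<open>x + e *\<^sub>R w\<close> is generic and in the cone with \<open>x\<close>. So the triangulation property for generic
  points carries over.\<close>

lemma half_open_decomposition:
  fixes h :: "'a::euclidean_space \<Rightarrow> real"
  assumes V: "finite V" "span V = UNIV" and h: "linear h" "\<forall>v\<in>V. h v = 1"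
    and \<omega>: "\<forall>B\<in>bases V. \<forall>v\<in>V - B. interpolant B \<omega> v \<noteq> \<omega> v"
    and w: "w \<in> conical_hull V" "generic V w"
  shows "conical_hull V = (\<Union>B\<in>regular_triangulation V \<omega>. half_open_cone B w)"
    and "disjoint_family_on (\<lambda>B. half_open_cone B w) (regular_triangulation V \<omega>)"
proof -
  define small where "small x e \<longleftrightarrow> (\<forall>B\<in>bases V. \<forall>b\<in>B.
      representation B (x + e *\<^sub>R w) b \<noteq> 0 \<and>
      (0 < representation B (x + e *\<^sub>R w) b \<longleftrightarrow> admissible (representation B w b) (representation B x b)))"
    for x e
  have "\<exists>e>0. small x e" for x
  proof -
    have "\<forall>\<^sub>F e in at_right 0. small x e"
      unfolding small_def using w(2) basesD(4)
      by (intro eventually_ball_finite ballI finite_bases V(1))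
        (auto simp: generic_def basis_representation_add basis_representation_scaleR
          intro!: eventually_positive_iff_admissible)
    then have "\<forall>\<^sub>F e in at_right 0. 0 < e \<and> small x e"
      by (intro eventually_conj) (simp_all add: eventually_at_right_less)
    then show ?thesis
      using eventually_happens'[OF trivial_limit_at_right_real] by blast
  qed
  then obtain e where e: "\<And>x. 0 < e x" and small: "\<And>x. small x (e x)"
    by metis
  have gen: "generic V (x + e x *\<^sub>R w)" for x
    using small[of x] by (simp add: generic_def small_def)
  have adm: "(\<forall>b\<in>B. 0 < representation B (x + e x *\<^sub>R w) b) \<longleftrightarrow> x \<in> half_open_cone B w"
    if "B \<in> bases V" for x B
    using small[of x] that by (simp add: small_def half_open_cone_def)
  have T: "B \<in> regular_triangulation V \<omega> \<Longrightarrow> B \<in> bases V" for B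
    by (simp add: regular_triangulation_def)
  show "conical_hull V = (\<Union>B\<in>regular_triangulation V \<omega>. half_open_cone B w)"
  proof
    show "conical_hull V \<subseteq> (\<Union>B\<in>regular_triangulation V \<omega>. half_open_cone B w)"
    proof
      fix x assume "x \<in> conical_hull V"
      then have "x + e x *\<^sub>R w \<in> conical_hull V"
        using w(1) e by (intro conical_hull_add conical_hull_scaleR less_imp_le)
      then obtain B where B: "B \<in> regular_triangulation V \<omega>"
          "\<forall>b\<in>B. 0 < representation B (x + e x *\<^sub>R w) b"
        using regular_triangulation_covers_generic[OF V h \<omega> _ gen] by blast
      then have "x \<in> half_open_cone B w"
        using adm[OF T] by blast
      with B(1) show "x \<in> (\<Union>B\<in>regular_triangulation V \<omega>. half_open_cone B w)"
        by blast
    qed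
    show "(\<Union>B\<in>regular_triangulation V \<omega>. half_open_cone B w) \<subseteq> conical_hull V"
      using half_open_cone_subset[OF V(1) T] by blast
  qed
  show "disjoint_family_on (\<lambda>B. half_open_cone B w) (regular_triangulation V \<omega>)"
    unfolding disjoint_family_on_def
  proof (intro ballI impI)
    fix B B' assume B: "B \<in> regular_triangulation V \<omega>" "B' \<in> regular_triangulation V \<omega>" "B \<noteq> B'"
    show "half_open_cone B w \<inter> half_open_cone B' w = {}"
      using regular_triangulation_cones_disjoint[OF B(1,2)] B(3) adm[OF T] B(1,2) by blast
  qed
qed

section \<open>Generating functions of lattice points by height\<close>

text \<open>The variable of the series stands for \<open>t\<^bsup>1/r\<^esup>\<close>.\<close>

definition height_series :: "('a \<Rightarrow> real) \<Rightarrow> nat \<Rightarrow> 'a set \<Rightarrow> rat fps" where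
  "height_series h r X = Abs_fps (\<lambda>n. of_nat (card {x \<in> X. h x = real n / real r}))"

text \<open>The half-open cone with the coordinates in \<open>S\<close> cut down to one period: to \<open>[0, 1)\<close>, or to \<open>(0, 1]\<close>
  where the facet is removed. In both cases exactly one integer translate of a real number is
  left, which is why the upper bound is expressed through \<open>admissible\<close> as well. For \<open>S = B\<close> this is the
  half-open parallelepiped.\<close>

definition truncated_cone :: "'a::real_vector set \<Rightarrow> 'a \<Rightarrow> 'a set \<Rightarrow> 'a set" where
  "truncated_cone B w S =
     {x \<in> half_open_cone B w. \<forall>b\<in>S. \<not> admissible (representation B w b) (representation B x b - 1)}"

lemma truncated_cone_split:
  assumes B: "B \<in> bases V" and b: "b \<in> B - S" and S: "S \<subseteq> B"
  shows "truncated_cone B w S = truncated_cone B w (insert b S) \<union> (+) b ` truncated_cone B w S"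
    and "truncated_cone B w (insert b S) \<inter> (+) b ` truncated_cone B w S = {}"
proof -
  have "x \<in> (+) b ` truncated_cone B w S \<longleftrightarrow> x \<in> truncated_cone B w S \<and>
      admissible (representation B w b) (representation B x b - 1)" for x
  proof -
    have rep: "representation B (x - b) a = representation B x a - (if a = b then 1 else 0)" for a
      using B b by (simp add: basis_representation_diff basis_representation_self)
    have "x \<in> (+) b ` truncated_cone B w S \<longleftrightarrow> x - b \<in> truncated_cone B w S"
      by (auto simp: image_iff algebra_simps intro: bexI[of _ "x - b"])
    also have "\<dots> \<longleftrightarrow> x \<in> truncated_cone B w S \<and>
        admissible (representation B w b) (representation B x b - 1)"
    proof -
      have "admissible \<mu> (t - 1) \<Longrightarrow> admissible \<mu> t" for \<mu> t
        by (auto simp: admissible_def)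
      moreover have "a \<noteq> b" if "a \<in> S" for a using that b by auto
      ultimately show ?thesis
        unfolding truncated_cone_def half_open_cone_def mem_Collect_eq rep
        using b by auto
    qed
    finally show ?thesis .
  qed
  then show "truncated_cone B w S = truncated_cone B w (insert b S) \<union> (+) b ` truncated_cone B w S"
    "truncated_cone B w (insert b S) \<inter> (+) b ` truncated_cone B w S = {}"
    by (auto simp: truncated_cone_def)
qed

text \<open>The points with the coordinate of \<open>b\<close> beyond its first period are the translates by \<open>b\<close> of all
  points of the less truncated cone. Translation by \<open>b\<close> preserves \<open>L\<close> and raises the height by \<open>1\<close>,
  that is, by \<open>r\<close> steps of size \<open>1/r\<close>.\<close>

lemma height_series_truncate:
  fixes h :: "'a::euclidean_space \<Rightarrow> real"
  assumes V: "finite V" and h: "linear h" "\<forall>v\<in>V. h v = 1" and r: "0 < r"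
    and L: "\<And>x v. v \<in> V \<Longrightarrow> x + v \<in> L \<longleftrightarrow> x \<in> L"
    and fin: "\<And>t. finite {x \<in> L \<inter> conical_hull V. h x = t}"
    and B: "B \<in> bases V" and b: "b \<in> B - S" and S: "S \<subseteq> B"
  shows "height_series h r (L \<inter> truncated_cone B w (insert b S)) =
    height_series h r (L \<inter> truncated_cone B w S) * (1 - fps_X ^ r)"
proof (rule fps_ext)
  fix n
  define A where "A = (\<lambda>S t. {x \<in> L \<inter> truncated_cone B w S. h x = t})"
  have sub: "truncated_cone B w S \<subseteq> conical_hull V" for S
    using half_open_cone_subset[OF V B] by (auto simp: truncated_cone_def)
  have finA: "finite (A S t)" for S t
    unfolding A_def using sub by (intro finite_subset[OF _ fin[of t]]) auto
  have bV: "b \<in> V" using b basesD(1)[OF B] by auto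
  have hb: "h (b + x) = h x + 1" for x
    using h bV by (simp add: linear_add)
  have Lb: "b + x \<in> L \<longleftrightarrow> x \<in> L" for x
    using L[OF bV, of x] by (simp add: add.commute)
  have "A S t = A (insert b S) t \<union> (+) b ` A S (t - 1)"
      "A (insert b S) t \<inter> (+) b ` A S (t - 1) = {}" for t
    using truncated_cone_split[OF B b S, of w] hb Lb unfolding A_def by (auto simp: image_iff) 
  then have card_add: "card (A S t) = card (A (insert b S) t) + card (A S (t - 1))" for t
    using card_Un_disjoint[OF finA finite_imageI[OF finA]] card_image[of "(+) b"]
    by (metis inj_on_add)
  have card: "rat_of_nat (card (A (insert b S) t)) = of_nat (card (A S t)) - of_nat (card (A S (t - 1)))" for t
    unfolding card_add[of t] by simp
  \<comment> \<open>There are no points of negative height, in accordance with the shift of the series.\<close>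
  have low: "A S (real n / real r - 1) = {}" if "n < r"
  proof -
    have "0 \<le> h x" if x: "x \<in> conical_hull V" for x
    proof -
      obtain c where c: "\<forall>v\<in>V. 0 \<le> c v" "x = (\<Sum>v\<in>V. c v *\<^sub>R v)"
        using x unfolding conical_hull_def by auto
      show ?thesis
        unfolding coefficients_le_height(1)[OF V h c] using c(1) by (simp add: sum_nonneg)
    qed
    moreover have "real n / real r - 1 < 0" using that by simp
    ultimately show ?thesis using sub unfolding A_def by fastforce
  qed
  have shift: "real n / real r - 1 = real (n - r) / real r" if "\<not> n < r"
    using that r by (simp add: field_simps of_nat_diff)
  show "height_series h r (L \<inter> truncated_cone B w (insert b S)) $ n =
    (height_series h r (L \<inter> truncated_cone B w S) * (1 - fps_X ^ r)) $ n"
    using card[of "real n / real r"] low shift unfolding A_def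
    by (cases "n < r") (simp_all only: height_series_def right_diff_distrib fps_sub_nth
        fps_X_power_mult_right_nth fps_nth_Abs_fps mult_1_right if_True if_False card.empty of_nat_0 simp_thms)
qed

lemma height_series_parallelepiped:
  fixes h :: "'a::euclidean_space \<Rightarrow> real"
  assumes V: "finite V" and h: "linear h" "\<forall>v\<in>V. h v = 1" and r: "0 < r"
    and L: "\<And>x v. v \<in> V \<Longrightarrow> x + v \<in> L \<longleftrightarrow> x \<in> L"
    and fin: "\<And>t. finite {x \<in> L \<inter> conical_hull V. h x = t}"
    and B: "B \<in> bases V"
  shows "height_series h r (L \<inter> truncated_cone B w B) =
    height_series h r (L \<inter> half_open_cone B w) * (1 - fps_X ^ r) ^ DIM('a)"
proof -
  have "finite S \<Longrightarrow> S \<subseteq> B \<Longrightarrow> height_series h r (L \<inter> truncated_cone B w S) =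
    height_series h r (L \<inter> half_open_cone B w) * (1 - fps_X ^ r) ^ card S" for S
  proof (induction S rule: finite_induct)
    case empty
    then show ?case by (simp add: truncated_cone_def)
  next
    case (insert b S)
    then show ?case
      using height_series_truncate[OF V h r L fin B, of b S w] by (simp add: mult_ac)
  qed
  from this[of B] show ?thesis
    using basesD[OF B] by simp
qed

lemma height_series_UN_disjoint:
  assumes "finite I" "disjoint_family_on X I"
    and "\<And>t. finite {x \<in> (\<Union>i\<in>I. X i). h x = t}"
  shows "height_series h r (\<Union>i\<in>I. X i) = (\<Sum>i\<in>I. height_series h r (X i))"
proof (rule fps_ext)
  fix n
  let ?A = "\<lambda>Y. {x \<in> Y. h x = real n / real r}"
  have "card (?A (\<Union>i\<in>I. X i)) = card (\<Union>i\<in>I. ?A (X i))"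
    by (rule arg_cong[where f = card]) auto
  also have "\<dots> = (\<Sum>i\<in>I. card (?A (X i)))"
  proof (rule card_UN_disjoint[OF assms(1)])
    show "\<forall>i\<in>I. finite (?A (X i))"
    proof
      fix i assume "i \<in> I"
      then show "finite (?A (X i))"
        by (intro finite_subset[OF _ assms(3)[of "real n / real r"]]) auto
    qed
    show "\<forall>i\<in>I. \<forall>j\<in>I. i \<noteq> j \<longrightarrow> ?A (X i) \<inter> ?A (X j) = {}"
      using assms(2) by (auto simp: disjoint_family_on_def)
  qed
  finally show "height_series h r (\<Union>i\<in>I. X i) $ n = (\<Sum>i\<in>I. height_series h r (X i)) $ n"
    by (simp add: height_series_def fps_sum_nth)
qed

lemma truncated_cone_height_le:
  fixes h :: "'a::euclidean_space \<Rightarrow> real"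
  assumes "B \<in> bases V" "linear h" "\<forall>v\<in>V. h v = 1" "x \<in> truncated_cone B w B"
  shows "h x \<le> real DIM('a)"
proof -
  have "representation B x b \<le> 1" if "b \<in> B" for b
    using assms(4) that by (force simp: truncated_cone_def admissible_def)
  then have "(\<Sum>b\<in>B. representation B x b) \<le> real (card B) * 1"
    by (intro sum_bounded_above)
  then show ?thesis
    using height_eq_sum_coordinates[OF assms(1-3)] basesD(5)[OF assms(1)] by simp
qed

text \<open>The numerator counts the points of \<open>L\<close> in the half-open parallelepipeds of the decomposition. It is a
  polynomial because the coordinates of these points are at most \<open>1\<close>, so the heights are at most the
  dimension.\<close>

theorem height_series_conical_hull:
  fixes h :: "'a::euclidean_space \<Rightarrow> real"
  assumes V: "finite V" "span V = UNIV" and h: "linear h" "\<forall>v\<in>V. h v = 1" and r: "0 < r"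
    and L: "\<And>x v. v \<in> V \<Longrightarrow> x + v \<in> L \<longleftrightarrow> x \<in> L"
    and fin: "\<And>t. finite {x \<in> L \<inter> conical_hull V. h x = t}"
  obtains p :: "int poly" where "\<forall>i. 0 \<le> coeff p i"
    "height_series h r (L \<inter> conical_hull V) * (1 - fps_X ^ r) ^ DIM('a) =
       fps_of_poly (map_poly of_int p)"
proof -
  obtain \<omega> where \<omega>: "\<forall>B\<in>bases V. \<forall>v\<in>V - B. interpolant B \<omega> v \<noteq> \<omega> v"
    using exists_generic_heights[OF V(1)] .
  obtain w where w: "w \<in> conical_hull V" "generic V w"
    using exists_generic_direction[OF V(1)] .
  define T where "T = regular_triangulation V \<omega>"
  have T: "T \<subseteq> bases V" "finite T"
    using finite_subset[OF _ finite_bases[OF V(1)]] by (auto simp: T_def regular_triangulation_def)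
  note dec = half_open_decomposition[OF V h \<omega> w, folded T_def]
  have cone: "L \<inter> conical_hull V = (\<Union>B\<in>T. L \<inter> half_open_cone B w)"
    using dec(1) by auto
  have "height_series h r (L \<inter> conical_hull V) = (\<Sum>B\<in>T. height_series h r (L \<inter> half_open_cone B w))"
    unfolding cone
  proof (rule height_series_UN_disjoint[OF T(2)])
    show "disjoint_family_on (\<lambda>B. L \<inter> half_open_cone B w) T"
      using dec(2) unfolding disjoint_family_on_def by blast
    show "finite {x \<in> \<Union>B\<in>T. L \<inter> half_open_cone B w. h x = t}" for t
      using fin[of t] unfolding cone .
  qed
  then have "height_series h r (L \<inter> conical_hull V) * (1 - fps_X ^ r) ^ DIM('a) =
      (\<Sum>B\<in>T. height_series h r (L \<inter> truncated_cone B w B))"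
    using height_series_parallelepiped[OF V(1) h r L fin] T(1)
    by (auto simp: sum_distrib_right intro!: sum.cong)
  moreover define a where
    "a = (\<lambda>n. \<Sum>B\<in>T. card {x \<in> L \<inter> truncated_cone B w B. h x = real n / real r})"
  ultimately have series:
    "height_series h r (L \<inter> conical_hull V) * (1 - fps_X ^ r) ^ DIM('a) = Abs_fps (\<lambda>n. of_nat (a n))"
    by (intro fps_ext) (simp add: height_series_def fps_sum_nth)
  have zero: "a n = 0" if n: "r * DIM('a) < n" for n
  proof -
    have empty: "{x \<in> L \<inter> truncated_cone B w B. h x = real n / real r} = {}" if "B \<in> T" for B
    proof -
      have "real DIM('a) < real n / real r"
        using n r by (simp add: field_simps flip: of_nat_mult)
      then show ?thesis
        using truncated_cone_height_le[OF _ h, of B _ w] that T(1) by fastforce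
    qed
    show ?thesis unfolding a_def by (intro sum.neutral ballI) (simp only: empty card.empty)
  qed
  define p where "p = Abs_poly (\<lambda>n. int (a n))"
  have p: "coeff p n = int (a n)" for n
    unfolding p_def using zero by (subst coeff_Abs_poly[of "r * DIM('a)"]) auto
  show thesis
  proof
    show "\<forall>i. 0 \<le> coeff p i" by (simp add: p)
    show "height_series h r (L \<inter> conical_hull V) * (1 - fps_X ^ r) ^ DIM('a) =
       fps_of_poly (map_poly of_int p)"
      unfolding series by (intro fps_ext) (simp add: coeff_map_poly p)
  qed
qed

section \<open>The cone over a lattice polytope\<close>

lemma finite_lattice_points_bounded:
  fixes X :: "(real ^ 'd) set"
  assumes "bounded X"
  shows "finite (X \<inter> lattice_points)"
proof -
  obtain M where M: "\<And>x. x \<in> X \<Longrightarrow> norm x \<le> M"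
    using assms by (auto simp: bounded_iff)
  let ?F = "{k \<in> \<int>. \<bar>k\<bar> \<le> M}"
  have F: "finite ?F"
  proof (rule finite_subset)
    show "?F \<subseteq> real_of_int ` {- \<lceil>M\<rceil>..\<lceil>M\<rceil>}"
    proof
      fix k :: real assume k: "k \<in> ?F"
      then obtain z where z: "k = of_int z" by (auto elim: Ints_cases)
      then have "- \<lceil>M\<rceil> \<le> z" "z \<le> \<lceil>M\<rceil>" using k by (auto simp: abs_le_iff) linarith+
      then show "k \<in> real_of_int ` {- \<lceil>M\<rceil>..\<lceil>M\<rceil>}" using z by auto
    qed
  qed simp
  have "X \<inter> lattice_points \<subseteq> vec_lambda ` (UNIV \<rightarrow>\<^sub>E ?F)"
  proof
    fix x assume x: "x \<in> X \<inter> lattice_points"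
    have "\<bar>x $ j\<bar> \<le> M" for j
      using component_le_norm_cart[of x j] M[of x] x by auto
    then have "vec_nth x \<in> UNIV \<rightarrow>\<^sub>E ?F"
      using x by (auto simp: lattice_points_def)
    moreover have "x = vec_lambda (vec_nth x)"
      by (simp add: vec_eq_iff)
    ultimately show "x \<in> vec_lambda ` (UNIV \<rightarrow>\<^sub>E ?F)"
      using image_eqI[of x vec_lambda "vec_nth x"] by blast
  qed
  then show ?thesis
    by (rule finite_subset) (intro finite_imageI finite_PiE F finite)
qed

text \<open>A vector \<open>(a, \<beta>)\<close> orthogonal to all \<open>(v, 1)\<close> would put \<open>V\<close> into the hyperplane \<open>a \<bullet> x = - \<beta>\<close>.\<close>

lemma span_homogenization:
  fixes V :: "(real ^ 'd) set"
  assumes "V \<noteq> {}" "aff_dim V = int CARD('d)"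
  shows "span ((\<lambda>v. (v, 1::real)) ` V) = UNIV"
proof (rule ccontr)
  assume "span ((\<lambda>v. (v, 1::real)) ` V) \<noteq> UNIV"
  then obtain z where z: "z \<noteq> 0" "\<And>y. y \<in> span ((\<lambda>v. (v, 1::real)) ` V) \<Longrightarrow> orthogonal z y"
    using orthogonal_to_subspace_exists_gen[of "(\<lambda>v. (v, 1::real)) ` V" UNIV]
    by (auto simp: psubset_eq)
  obtain a \<beta> where ab: "z = (a, \<beta>)" by (cases z)
  have eq: "a \<bullet> v + \<beta> = 0" if "v \<in> V" for v
    using z(2)[of "(v, 1)"] that by (auto simp: span_base ab orthogonal_def inner_Pair)
  have "a \<noteq> 0"
    using eq assms(1) z(1) ab by (auto simp: zero_prod_def)
  moreover have "V \<subseteq> {x. a \<bullet> x = - \<beta>}"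
    using eq by (auto simp: eq_neg_iff_add_eq_0)
  ultimately have "aff_dim V \<le> int CARD('d) - 1"
    using aff_dim_subset[of V "{x. a \<bullet> x = - \<beta>}"] aff_dim_hyperplane[of a "- \<beta>"] by simp
  with assms(2) show False by simp
qed

lemma conical_hull_homogenization:
  fixes V :: "(real ^ 'd) set"
  assumes "finite V" "V \<noteq> {}" "0 \<le> t"
  shows "(x, t) \<in> conical_hull ((\<lambda>v. (v, 1)) ` V) \<longleftrightarrow> x \<in> (\<lambda>y. t *\<^sub>R y) ` (convex hull V)"
proof -
  have comb: "(\<Sum>u\<in>(\<lambda>v. (v, 1::real)) ` V. c u *\<^sub>R u) = (\<Sum>v\<in>V. c (v, 1) *\<^sub>R v, \<Sum>v\<in>V. c (v, 1))" for c
    by (subst sum.reindex) (auto simp: inj_on_def scaleR_prod_def sum_prod)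
  show ?thesis
  proof
    assume "(x, t) \<in> conical_hull ((\<lambda>v. (v, 1)) ` V)"
    then obtain c where c: "\<forall>v\<in>V. 0 \<le> c (v, 1::real)"
      "x = (\<Sum>v\<in>V. c (v, 1) *\<^sub>R v)" "t = (\<Sum>v\<in>V. c (v, 1))"
      unfolding conical_hull_def comb by auto
    show "x \<in> (\<lambda>y. t *\<^sub>R y) ` (convex hull V)"
    proof (cases "t = 0")
      case True
      then have "x = 0"
        using c sum_nonneg_eq_0_iff[OF assms(1), of "\<lambda>v. c (v, 1)"] by simp
      moreover have "(\<lambda>y. t *\<^sub>R y) ` (convex hull V) = {0}"
        using True assms(2) by (simp add: image_constant_conv)
      ultimately show ?thesis by simp
    next
      case False
      have "(\<Sum>v\<in>V. c (v, 1) / t) = 1"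
        unfolding sum_divide_distrib[symmetric] c(3)[symmetric] using False by simp
      moreover have "\<forall>v\<in>V. 0 \<le> c (v, 1) / t"
        using c(1) assms(3) by simp
      ultimately have "(\<Sum>v\<in>V. (c (v, 1) / t) *\<^sub>R v) \<in> convex hull V"
        unfolding convex_hull_finite[OF assms(1)]
        by (intro CollectI exI[of _ "\<lambda>v. c (v, 1) / t"]) simp
      moreover have "x = t *\<^sub>R (\<Sum>v\<in>V. (c (v, 1) / t) *\<^sub>R v)"
        unfolding c(2) scaleR_sum_right using False by simp
      ultimately show ?thesis by blast
    qed
  next
    assume "x \<in> (\<lambda>y. t *\<^sub>R y) ` (convex hull V)"
    then obtain c where c: "\<forall>v\<in>V. 0 \<le> c v" "sum c V = 1" "x = t *\<^sub>R (\<Sum>v\<in>V. c v *\<^sub>R v)"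
      unfolding convex_hull_finite[OF assms(1)] by auto
    show "(x, t) \<in> conical_hull ((\<lambda>v. (v, 1)) ` V)"
      unfolding conical_hull_def
    proof (intro CollectI exI[of _ "\<lambda>u. t * c (fst u)"] conjI)
      show "\<forall>v\<in>(\<lambda>v. (v, 1::real)) ` V. 0 \<le> t * c (fst v)"
        using c(1) assms(3) by auto
      show "(x, t) = (\<Sum>u\<in>(\<lambda>v. (v, 1)) ` V. (t * c (fst u)) *\<^sub>R u)"
        unfolding comb fst_conv c(3) sum_distrib_left[symmetric] c(2) scaleR_sum_right by simp
    qed
  qed
qed

lemma codenominator_pos:
  fixes P :: "(real ^ 'd) set"
  assumes "has_codenominator P r"
  shows "0 < r"
proof -
  obtain H where "halfspace_description P H" and r: "int r = Lcm {b \<in> snd ` H. b \<noteq> 0}"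
    using assms by (auto simp: has_codenominator_def)
  then have "finite H"
    by (simp add: halfspace_description_def)
  then have "Lcm {b \<in> snd ` H. b \<noteq> 0} \<noteq> 0"
    by (subst Lcm_0_iff) auto
  then show ?thesis using r by simp
qed

theorem corollary11:
  fixes P :: "(real ^ 'd) set" and r :: nat
  assumes "lattice_polytope P"
    and "aff_dim P = int CARD('d)"
    and "has_codenominator P r"
  shows "\<exists>h :: int poly. (\<forall>i. coeff h i \<ge> 0) \<and>
           Ehr P r = fps_of_poly (map_poly of_int h) / (1 - fps_X ^ r) ^ (CARD('d) + 1)"
proof -
  have r: "0 < r" using assms(3) by (rule codenominator_pos)
  obtain V where V: "finite V" "V \<subseteq> lattice_points" and P: "P = convex hull V"
    using assms(1) unfolding lattice_polytope_def by blast
  have ne: "V \<noteq> {}" using assms(2) P by auto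
  define W where "W = (\<lambda>v. (v, 1::real)) ` V"
  \<comment> \<open>The last component is left free, as the heights \<open>n/r\<close> are selected by \<open>height_series\<close>.\<close>
  define L where "L = (lattice_points :: (real ^ 'd) set) \<times> (UNIV :: real set)"
  have W: "finite W" "\<forall>v\<in>W. snd v = 1" "span W = UNIV"
    using V(1) span_homogenization[OF ne] assms(2) by (auto simp: W_def P aff_dim_convex_hull)
  have slice: "{p \<in> L \<inter> conical_hull W. snd p = t} =
      (\<lambda>x. (x, t)) ` ((\<lambda>x. t *\<^sub>R x) ` P \<inter> lattice_points)" if "0 \<le> t" for t
    using conical_hull_homogenization[OF V(1) ne that] by (auto simp: L_def W_def P)
  have fin: "finite {p \<in> L \<inter> conical_hull W. snd p = t}" for t
  proof (rule finite_subset)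
    have "bounded (fst ` {p \<in> conical_hull W. snd p = t})"
      by (intro bounded_fst bounded_conical_hull_slice W linear_snd)
    then show "finite ((fst ` {p \<in> conical_hull W. snd p = t} \<inter> lattice_points) \<times> {t})"
      using finite_lattice_points_bounded by blast
    show "{p \<in> L \<inter> conical_hull W. snd p = t} \<subseteq>
        (fst ` {p \<in> conical_hull W. snd p = t} \<inter> lattice_points) \<times> {t}"
      by (force simp: L_def)
  qed
  have L: "p + v \<in> L \<longleftrightarrow> p \<in> L" if "v \<in> W" for p v
  proof -
    have "\<forall>j. fst v $ j \<in> \<int>"
      using that V(2) by (auto simp: W_def lattice_points_def)
    then have "fst p $ j + fst v $ j \<in> \<int> \<longleftrightarrow> fst p $ j \<in> \<int>" for j
      by (metis Ints_add Ints_diff add_diff_cancel_right')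
    then show ?thesis
      by (simp add: L_def lattice_points_def mem_Times_iff)
  qed
  obtain p :: "int poly" where p: "\<forall>i. 0 \<le> coeff p i"
    "height_series snd r (L \<inter> conical_hull W) * (1 - fps_X ^ r) ^ DIM((real ^ 'd) \<times> real) =
       fps_of_poly (map_poly of_int p)"
    using height_series_conical_hull[OF W(1,3) linear_snd W(2) r L fin] by blast
  have "Ehr P r = height_series snd r (L \<inter> conical_hull W)"
  proof (rule fps_ext)
    fix n
    define t where "t = real n / real r"
    have "card {p \<in> L \<inter> conical_hull W. snd p = t} = card ((\<lambda>x. t *\<^sub>R x) ` P \<inter> lattice_points)"
      by (subst slice) (auto simp: t_def card_image inj_on_def)
    moreover have "(\<lambda>x. 0 *\<^sub>R x) ` P \<inter> lattice_points = {0}"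
      using ne by (auto simp: P lattice_points_def image_constant_conv)
    ultimately show "Ehr P r $ n = height_series snd r (L \<inter> conical_hull W) $ n"
      by (auto simp: Ehr_def ehr_def height_series_def t_def of_rat_divide)
  qed
  moreover have "(1 - fps_X ^ r :: rat fps) ^ (CARD('d) + 1) \<noteq> 0"
  proof -
    have "(1 - fps_X ^ r :: rat fps) $ 0 \<noteq> 0" using r by simp
    then have "(1 - fps_X ^ r :: rat fps) \<noteq> 0" by force
    then show ?thesis by simp
  qed
  ultimately have "Ehr P r = fps_of_poly (map_poly of_int p) / (1 - fps_X ^ r) ^ (CARD('d) + 1)"
    using p(2) by (metis DIM_cart DIM_prod DIM_real mult.right_neutral nonzero_mult_div_cancel_right)
  with p(1) show ?thesis by blast
qed

end
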